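(* Let $P=([n],\preceq)$ be a poset, $w$ a weight on $\mathbb{F}_q$, and $\mathbb{C}\subseteq\mathbb{F}_q^n$ a code with $|\mathbb{C}|\ge2$. If $\mathbb{C}$ is MDS with respect to the $(P,w)$-metric, then $\mathbb{C}$ is MDS with respect to the $P$-metric.
   Context: A weight on $\mathbb{F}_q$ is a map $w:\mathbb{F}_q\to\mathbb{N}\cup\{0\}$ with $w(\alpha)=0$ iff $\alpha=0$, $w(-\alpha)=w(\alpha)$, $w(\alpha+\beta)\le w(\alpha)+w(\beta)$; $M_w=\max_\alpha w(\alpha)$. Ideals of $P$ are down-closed subsets; $\langle A\rangle$ is the generated ideal. For $u\in\mathbb{F}_q^n$, $supp(u)=\{i:u_i\ne0\}$, $I_u=\langle supp(u)\rangle$, $M_u$ its maximal elements, $w_{(P,w)}(u)=\sum_{i\in M_u}w(u_i)+|I_u\setminus M_u|\,M_w$, $w_P(u)=|I_u|$; distances are weights of differences and $d_{(P,w)}(\mathbb{C})$, $d_P(\mathbb{C})$ are minimum distances between distinct codewords. $\mathbb{C}$ is MDS w.r.t. the $(P,w)$-metric if $\lfloor(d_{(P,w)}(\mathbb{C})-1)/M_w\rfloor=n-\lceil\log_q|\mathbb{C}|\rceil$, and MDS w.r.t. the $P$-metric if $d_P(\mathbb{C})-1=n-\lceil\log_q|\mathbb{C}|\rceil$ (in each case the left side is always at most the right side). *)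

theory Defs
  imports "HOL-Analysis.Analysis"
begin

text \<open>
  The field with \<open>q\<close> elements is a type \<open>'a :: {field, finite}\<close> with \<open>q = CARD('a)\<close>; the index
  set \<open>[n]\<close> is a type \<open>'n :: finite\<close> with \<open>n = CARD('n)\<close>, so that words are vectors of type
  \<open>'a ^ 'n\<close>. A partial order on the index set is a relation \<open>P\<close> with \<open>partial_order_on UNIV P\<close>,
  where \<open>(i, j) \<in> P\<close> means that \<open>i\<close> is below or equal to \<open>j\<close>.
\<close>

definition is_weight :: "('a::{field,finite} \<Rightarrow> nat) \<Rightarrow> bool" where
  "is_weight w \<longleftrightarrow>
     (\<forall>a. w a = 0 \<longleftrightarrow> a = 0) \<and>
     (\<forall>a. w (- a) = w a) \<and>
     (\<forall>a b. w (a + b) \<le> w a + w b)"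

definition max_weight :: "('a::{field,finite} \<Rightarrow> nat) \<Rightarrow> nat" where
  "max_weight w = Max (range w)"

definition is_order_ideal :: "('n \<times> 'n) set \<Rightarrow> 'n set \<Rightarrow> bool" where
  "is_order_ideal P I \<longleftrightarrow> (\<forall>i j. j \<in> I \<longrightarrow> (i, j) \<in> P \<longrightarrow> i \<in> I)"

definition generated_ideal :: "('n \<times> 'n) set \<Rightarrow> 'n set \<Rightarrow> 'n set" where
  "generated_ideal P A = is_order_ideal P hull A"

definition maximal_elements :: "('n \<times> 'n) set \<Rightarrow> 'n set \<Rightarrow> 'n set" where
  "maximal_elements P I = {i \<in> I. \<forall>j\<in>I. (i, j) \<in> P \<longrightarrow> j = i}"

definition supp :: "('a::zero) ^ 'n \<Rightarrow> 'n set" where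
  "supp u = {i. u $ i \<noteq> 0}"

definition supp_ideal :: "('n \<times> 'n) set \<Rightarrow> ('a::zero) ^ 'n \<Rightarrow> 'n set" where
  "supp_ideal P u = generated_ideal P (supp u)"

definition supp_maximal :: "('n \<times> 'n) set \<Rightarrow> ('a::zero) ^ 'n \<Rightarrow> 'n set" where
  "supp_maximal P u = maximal_elements P (supp_ideal P u)"

definition P_weight :: "('n::finite \<times> 'n) set \<Rightarrow> ('a::{field,finite}) ^ 'n \<Rightarrow> nat" where
  "P_weight P u = card (supp_ideal P u)"

definition Pw_weight ::
  "('n::finite \<times> 'n) set \<Rightarrow> ('a::{field,finite} \<Rightarrow> nat) \<Rightarrow> 'a ^ 'n \<Rightarrow> nat" where
  "Pw_weight P w u =
     (\<Sum>i\<in>supp_maximal P u. w (u $ i)) +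
     card (supp_ideal P u - supp_maximal P u) * max_weight w"

definition P_dist ::
  "('n::finite \<times> 'n) set \<Rightarrow> ('a::{field,finite}) ^ 'n \<Rightarrow> 'a ^ 'n \<Rightarrow> nat" where
  "P_dist P u v = P_weight P (u - v)"

definition Pw_dist ::
  "('n::finite \<times> 'n) set \<Rightarrow> ('a::{field,finite} \<Rightarrow> nat) \<Rightarrow> 'a ^ 'n \<Rightarrow> 'a ^ 'n \<Rightarrow> nat" where
  "Pw_dist P w u v = Pw_weight P w (u - v)"

text \<open>Only meaningful for codes with at least two (and finitely many) words, because of \<^const>\<open>Min\<close>.\<close>

definition min_distance :: "('v \<Rightarrow> 'v \<Rightarrow> nat) \<Rightarrow> 'v set \<Rightarrow> nat" where
  "min_distance d C = Min {d u v | u v. u \<in> C \<and> v \<in> C \<and> u \<noteq> v}"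

definition MDS_P :: "('n::finite \<times> 'n) set \<Rightarrow> ('a::{field,finite} ^ 'n) set \<Rightarrow> bool" where
  "MDS_P P C \<longleftrightarrow>
     int (min_distance (P_dist P) C) - 1 =
     int CARD('n) - \<lceil>log (real CARD('a)) (real (card C))\<rceil>"

definition MDS_Pw ::
  "('n::finite \<times> 'n) set \<Rightarrow> ('a::{field,finite} \<Rightarrow> nat) \<Rightarrow> ('a ^ 'n) set \<Rightarrow> bool" where
  "MDS_Pw P w C \<longleftrightarrow>
     \<lfloor>(real (min_distance (Pw_dist P w) C) - 1) / real (max_weight w)\<rfloor> =
     int CARD('n) - \<lceil>log (real CARD('a)) (real (card C))\<rceil>"

end

theory Submission
  imports Defs
begin

text \<open>
  Every coordinate of \<open>I\<^sub>u\<close> contributes at most \<open>M\<^sub>w\<close> to the \<open>(P,w)\<close>-weight, so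
  \<open>d\<^bsub>(P,w)\<^esub>(C) \<le> M\<^sub>w d\<^sub>P(C)\<close> and hence \<open>\<lfloor>(d\<^bsub>(P,w)\<^esub>(C) - 1) / M\<^sub>w\<rfloor> \<le> d\<^sub>P(C) - 1\<close>. The Singleton bound
  \<open>d\<^sub>P(C) - 1 \<le> n - \<lceil>log\<^sub>q |C|\<rceil>\<close> closes the gap: two words agreeing outside an ideal with
  \<open>d\<^sub>P(C) - 1\<close> elements are at distance less than \<open>d\<^sub>P(C)\<close>, so puncturing \<open>C\<close> at such an ideal is
  injective.
\<close>

text \<open>Ideals grow one element at a time: a minimal element \<open>m\<close> of the complement
  has everything strictly below it in \<open>J\<close>, so adding \<open>m\<close> to
  \<open>J\<close> keeps it down-closed.\<close>

lemma exists_order_ideal_card: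
  fixes P :: "('n::finite \<times> 'n) set"
  assumes "partial_order_on UNIV P" and "k \<le> CARD('n)"
  shows "\<exists>J. is_order_ideal P J \<and> card J = k"
  using assms(2)
proof (induction k)
  case 0
  show ?case by (rule exI[of _ "{}"]) (simp add: is_order_ideal_def)
next
  case (Suc k)
  then obtain J where J: "is_order_ideal P J" "card J = k" by auto
  have "J \<noteq> UNIV"
    using J(2) Suc.prems by auto
  then have ne: "- J \<noteq> {}" by blast
  have tr: "trans P" and an: "antisym P"
    using assms(1) by (auto simp: partial_order_on_def preorder_on_def)
  \<comment> \<open>The strict part of \<open>P\<close> is asymmetric and transitive, hence has a
    minimal element on the finite nonempty set \<open>- J\<close>.\<close>
  define R where "R = (\<lambda>x y. (x, y) \<in> P \<and> x \<noteq> y)"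
  have "asymp_on (- J) R" "transp_on (- J) R"
    using tr an unfolding R_def asymp_on_def transp_on_def antisym_def trans_def by blast+
  with ne obtain m where m: "m \<in> - J" "\<forall>x\<in>- J. x \<noteq> m \<longrightarrow> \<not> R x m"
    using Finite_Set.bex_min_element[of "- J" R] by auto
  have "is_order_ideal P (insert m J)"
    using J(1) m(2) unfolding is_order_ideal_def R_def by blast
  moreover have "card (insert m J) = Suc k"
    using J(2) m(1) by simp
  ultimately show ?case by blast
qed

lemma supp_subset_supp_ideal: "supp u \<subseteq> supp_ideal P u"
  unfolding supp_ideal_def generated_ideal_def by (rule hull_subset)

lemma P_weight_le_card:
  assumes "is_order_ideal P J" and "supp u \<subseteq> J"
  shows "P_weight P u \<le> card J"
  using assms unfolding P_weight_def supp_ideal_def generated_ideal_def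
  by (intro card_mono hull_minimal) auto

lemma P_weight_pos:
  assumes "u \<noteq> 0"
  shows "P_weight P u > 0"
proof -
  have "supp u \<noteq> {}"
    using assms by (auto simp: supp_def vec_eq_iff)
  then show ?thesis
    using supp_subset_supp_ideal[of u P] by (auto simp: P_weight_def card_gt_0_iff)
qed

lemma weight_le_max_weight: "w a \<le> max_weight w"
  by (simp add: max_weight_def)

text \<open>This makes division by \<open>max_weight w\<close> legitimate; the weight of 1 already
  witnesses it.\<close>

lemma max_weight_pos:
  assumes "is_weight w"
  shows "max_weight w > 0"
proof -
  have "w 1 > 0"
    using assms by (metis is_weight_def gr0I zero_neq_one)
  then show ?thesis
    using weight_le_max_weight[of w 1] by linarith
qed

lemma Pw_weight_le: "Pw_weight P w u \<le> P_weight P u * max_weight w"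
proof -
  have sub: "supp_maximal P u \<subseteq> supp_ideal P u"
    by (auto simp: supp_maximal_def maximal_elements_def)
  have "(\<Sum>i\<in>supp_maximal P u. w (u $ i)) \<le> card (supp_maximal P u) * max_weight w"
    using sum_bounded_above[of "supp_maximal P u" "\<lambda>i. w (u $ i)" "max_weight w"]
    by (simp add: weight_le_max_weight)
  moreover have "card (supp_ideal P u) =
      card (supp_maximal P u) + card (supp_ideal P u - supp_maximal P u)"
    using sub by (simp add: card_Diff_subset card_mono)
  ultimately show ?thesis
    by (simp add: Pw_weight_def P_weight_def algebra_simps)
qed

lemma finite_distances:
  assumes "finite C"
  shows "finite {d u v | u v. u \<in> C \<and> v \<in> C \<and> u \<noteq> v}"
proof (rule finite_subset)
  show "{d u v | u v. u \<in> C \<and> v \<in> C \<and> u \<noteq> v} \<subseteq> case_prod d ` (C \<times> C)"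
    by force
qed (use assms in simp)

lemma min_distance_le:
  assumes "finite C" "u \<in> C" "v \<in> C" "u \<noteq> v"
  shows "min_distance d C \<le> d u v"
  unfolding min_distance_def by (rule Min_le[OF finite_distances[OF assms(1)]]) (use assms in blast)

lemma min_distance_attained:
  assumes "card C \<ge> 2"
  obtains u v where "u \<in> C" "v \<in> C" "u \<noteq> v" "min_distance d C = d u v"
proof -
  \<comment> \<open>An infinite set has \<open>card\<close> 0, so the bound on \<open>card C\<close>
    forces finiteness.\<close>
  have "finite C"
    using assms by (intro card_ge_0_finite) simp
  have "\<not> is_singleton C" "C \<noteq> {}"
    using assms by (auto simp: is_singleton_altdef)
  then obtain x y where "x \<in> C" "y \<in> C" "x \<noteq> y"
    by (metis all_not_in_conv is_singletonI')
  then have "{d u v | u v. u \<in> C \<and> v \<in> C \<and> u \<noteq> v} \<noteq> {}" by blast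
  from Min_in[OF finite_distances[OF \<open>finite C\<close>] this] show ?thesis
    using that by (auto simp: min_distance_def)
qed

lemma card_code_le:
  fixes C :: "('a::{field,finite} ^ 'n::finite) set"
  assumes "partial_order_on UNIV P" "k < min_distance (P_dist P) C" "k \<le> CARD('n)"
  shows "card C \<le> CARD('a) ^ (CARD('n) - k)"
proof -
  obtain J where J: "is_order_ideal P J" "card J = k"
    using exists_order_ideal_card[OF assms(1,3)] by blast
  define puncture :: "'a ^ 'n \<Rightarrow> 'n \<Rightarrow> 'a" where
    \<comment> \<open>\<open>restrict\<close> sends the coordinates in \<open>J\<close> to
      \<open>undefined\<close>, so punctured words lie in a \<open>PiE\<close> space over
      \<open>- J\<close>, whose size is a power of q.\<close>
    "puncture = (\<lambda>u. restrict (($) u) (- J))"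
  have "inj_on puncture C"
  proof (rule inj_onI, rule ccontr)
    fix u v assume uv: "u \<in> C" "v \<in> C" "puncture u = puncture v" "u \<noteq> v"
    have "u $ i = v $ i" if "i \<notin> J" for i
      using fun_cong[OF uv(3), of i] that by (simp add: puncture_def)
    then have "supp (u - v) \<subseteq> J"
      by (auto simp: supp_def)
    \<comment> \<open>Here \<open>J\<close> must be an ideal: it then contains the whole ideal
      generated by the support, not only the support.\<close>
    then have "P_dist P u v \<le> k"
      using P_weight_le_card[OF J(1)] J(2) by (simp add: P_dist_def)
    moreover have "min_distance (P_dist P) C \<le> P_dist P u v"
      using uv by (intro min_distance_le) auto
    ultimately show False
      using assms(2) by linarith
  qed
  then have "card C = card (puncture ` C)"
    by (simp add: card_image)
  also have "\<dots> \<le> card (PiE (- J) (\<lambda>_. UNIV :: 'a set))"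
    by (rule card_mono) (auto simp: puncture_def intro: finite_PiE)
  also have "\<dots> = CARD('a) ^ (CARD('n) - k)"
    using J(2) card_Diff_subset[of J UNIV] by (simp add: card_PiE Compl_eq_Diff_UNIV[symmetric])
  finally show ?thesis .
qed

lemma singleton_bound:
  fixes C :: "('a::{field,finite} ^ 'n::finite) set"
  assumes "partial_order_on UNIV P" "card C \<ge> 2"
  shows "int (min_distance (P_dist P) C) - 1 \<le>
    int CARD('n) - \<lceil>log (real CARD('a)) (real (card C))\<rceil>"
proof -
  let ?d = "min_distance (P_dist P) C"
  obtain u v where uv: "u \<in> C" "v \<in> C" "u \<noteq> v" "?d = P_dist P u v"
    using min_distance_attained[OF assms(2), where d = "P_dist P"] .
  have "?d > 0"
    using uv(3,4) P_weight_pos[of "u - v" P] by (simp add: P_dist_def)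
  have "?d \<le> CARD('n)"
    using uv(4) by (simp add: P_dist_def P_weight_def card_mono)
  have "card {0, 1 :: 'a} \<le> CARD('a)"
    by (rule card_mono) auto
  then have q: "real CARD('a) > 1" by simp
  \<comment> \<open>The best admissible choice is k = \<open>?d - 1\<close>; as \<open>?d\<close> is
    positive, the truncated subtraction is exact and k < \<open>?d\<close>.\<close>
  have "card C \<le> CARD('a) ^ (CARD('n) - (?d - 1))"
    using card_code_le[OF assms(1), of "?d - 1" C] \<open>?d > 0\<close> \<open>?d \<le> CARD('n)\<close> by linarith
  then have "real (card C) \<le> real CARD('a) ^ (CARD('n) - (?d - 1))"
    by (metis of_nat_le_iff of_nat_power)
  then have "log (real CARD('a)) (real (card C)) \<le> real (CARD('n) - (?d - 1))"
    using q assms(2) by (intro log_of_power_le) auto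
  then have "\<lceil>log (real CARD('a)) (real (card C))\<rceil> \<le> int (CARD('n) - (?d - 1))"
    by (simp add: ceiling_le_iff)
  then show ?thesis
    using \<open>?d > 0\<close> \<open>?d \<le> CARD('n)\<close> by linarith
qed

lemma floor_min_distance_Pw_le:
  fixes C :: "('a::{field,finite} ^ 'n::finite) set"
  assumes "is_weight w" "card C \<ge> 2"
  shows "\<lfloor>(real (min_distance (Pw_dist P w) C) - 1) / real (max_weight w)\<rfloor>
    \<le> int (min_distance (P_dist P) C) - 1"
proof -
  let ?d = "min_distance (P_dist P) C"
  obtain u v where uv: "u \<in> C" "v \<in> C" "u \<noteq> v" "?d = P_dist P u v"
    using min_distance_attained[OF assms(2), where d = "P_dist P"] .
  \<comment> \<open>The pair attaining the \<open>P\<close>-distance need not attain the other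
    minimum, but it bounds that minimum from above.\<close>
  have "min_distance (Pw_dist P w) C \<le> Pw_dist P w u v"
    using uv by (intro min_distance_le) auto
  also have "\<dots> \<le> ?d * max_weight w"
    using uv(4) Pw_weight_le[of P w "u - v"] by (simp add: Pw_dist_def P_dist_def)
  finally have "real (min_distance (Pw_dist P w) C) \<le> real ?d * real (max_weight w)"
    by (metis of_nat_le_iff of_nat_mult)
  \<comment> \<open>Subtracting 1 makes the inequality strict, so the floor falls below the integer
    \<open>?d\<close>.\<close>
  then have "(real (min_distance (Pw_dist P w) C) - 1) / real (max_weight w) < real ?d"
    using max_weight_pos[OF assms(1)] by (simp add: divide_less_eq)
  then have "\<lfloor>(real (min_distance (Pw_dist P w) C) - 1) / real (max_weight w)\<rfloor> < int ?d"
    by (simp add: floor_less_iff)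
  then show ?thesis by linarith
qed

theorem theorem4p4:
  fixes P :: "('n::finite \<times> 'n) set"
    and w :: "'a::{field,finite} \<Rightarrow> nat"
    and C :: "('a ^ 'n) set"
  assumes "partial_order_on UNIV P"
    and "is_weight w"
    and "card C \<ge> 2"
    and "MDS_Pw P w C"
  shows "MDS_P P C"
  using singleton_bound[OF assms(1,3)] floor_min_distance_Pw_le[OF assms(2,3), of P] assms(4)
  unfolding MDS_P_def MDS_Pw_def by linarith

end
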